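(* Let $V$ be a set of $n\ge 2$ vertices. The maximum number of Hamiltonian paths on $V$ such that the union of any two distinct paths of the family contains a triangle is equal to the number of balanced bipartitions of $V$ (that is, the number of unordered partitions $\{A,B\}$ of $V$ with $||A|-|B||\le 1$; equivalently $\binom{2m+1}{m}$ both for $n=2m+1$ and for $n=2m+2$).
   Context: A Hamiltonian path on $V$ is a subgraph of the complete graph on $V$ that is a path (of length $n-1$) through all vertices of $V$; it is regarded as an (unordered) edge set, so a path and its reversal are the same. The union of two graphs on the same vertex set $V$ is the graph on $V$ whose edge set is the union of their edge sets. "Contains a triangle" means contains three pairwise adjacent vertices. *)

theory Defs
  imports Main
begin

text \<open>A graph on a fixed vertex set is represented by its edge set, a set of two-element sets of
  vertices; the union of two graphs on the same vertex set is then the union of the edge sets.\<close>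

definition path_edges :: "'a list \<Rightarrow> 'a set set" where
  "path_edges xs = {{xs ! i, xs ! Suc i} | i. Suc i < length xs}"

definition hamiltonian_path :: "'a set \<Rightarrow> 'a set set \<Rightarrow> bool" where
  "hamiltonian_path V P \<longleftrightarrow> (\<exists>xs. distinct xs \<and> set xs = V \<and> P = path_edges xs)"

definition contains_triangle :: "'a set set \<Rightarrow> bool" where
  "contains_triangle E \<longleftrightarrow>
    (\<exists>x y z. x \<noteq> y \<and> y \<noteq> z \<and> x \<noteq> z \<and> {x, y} \<in> E \<and> {y, z} \<in> E \<and> {x, z} \<in> E)"

definition triangle_creating_family :: "'a set \<Rightarrow> 'a set set set \<Rightarrow> bool" where
  "triangle_creating_family V F \<longleftrightarrow>
    (\<forall>P\<in>F. hamiltonian_path V P) \<and>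
    (\<forall>P\<in>F. \<forall>Q\<in>F. P \<noteq> Q \<longrightarrow> contains_triangle (P \<union> Q))"

text \<open>The partition is unordered: \<open>{A, B}\<close> below is a set of sets. When \<open>V\<close> has at least
  two elements, the balance condition forces both parts to be nonempty.\<close>

definition balanced_bipartitions :: "'a set \<Rightarrow> 'a set set set" where
  "balanced_bipartitions V =
    {{A, B} | A B. A \<union> B = V \<and> A \<inter> B = {} \<and> \<bar>int (card A) - int (card B)\<bar> \<le> 1}"

text \<open>The following two facts show that the maximum over all such families is attained.\<close>

lemma finite_triangle_creating_families:
  assumes "finite V"
  shows "finite {F. triangle_creating_family V F}"
proof (rule finite_subset)
  show "{F. triangle_creating_family V F} \<subseteq> Pow (Pow (Pow V))"
    by (auto simp: triangle_creating_family_def hamiltonian_path_def path_edges_def subset_iff)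
  show "finite (Pow (Pow (Pow V)))"
    using assms by simp
qed

lemma triangle_creating_family_empty: "triangle_creating_family V {}"
  by (simp add: triangle_creating_family_def)

end

theory Submission
  imports Defs
begin

text \<open>Two paths whose alternating 2-colourings induce the same bipartition have a bipartite union;
  this gives the upper bound. For the lower bound, a balanced 2-colouring is determined by
  comparing the colours of pairs of vertices adaptively, and a path is built in which each compared
  pair is adjacent when the colours differ and has a common neighbour when they agree. Two
  inequivalent colourings first disagree at some comparison, and the two answers give a triangle.

  The comparisons are those of binary majority counting. One keeps monochromatic runs whose lengths
  are powers of two. When two runs of equal length agree they are concatenated. When they differ,
  they are interleaved into a block and removed; the block has two forms \<open>x\<^sub>1 y\<^sub>1 x\<^sub>2 y\<^sub>2 \<dots>\<close> and
  \<open>y\<^sub>1 x\<^sub>1 y\<^sub>2 x\<^sub>2 \<dots>\<close>, and which of them is attached to the path of the remaining vertices encodes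
  the colour of the block relative to the rest. Once all lengths are distinct, balance forces the
  longest run to have the colour opposite to all the others.\<close>

section \<open>Vocabulary for colourings and graphs\<close>

definition same_bipartition :: "'a set \<Rightarrow> ('a \<Rightarrow> bool) \<Rightarrow> ('a \<Rightarrow> bool) \<Rightarrow> bool" where
  "same_bipartition V c d \<longleftrightarrow> (\<forall>x\<in>V. \<forall>y\<in>V. (c x = c y) = (d x = d y))"

definition balanced :: "'a set \<Rightarrow> ('a \<Rightarrow> bool) \<Rightarrow> bool" where
  "balanced V c \<longleftrightarrow> \<bar>int (card {x\<in>V. c x}) - int (card {x\<in>V. \<not> c x})\<bar> \<le> 1"

definition classes :: "'a set \<Rightarrow> ('a \<Rightarrow> bool) \<Rightarrow> 'a set set" where
  "classes V c = {{x\<in>V. c x}, {x\<in>V. \<not> c x}}"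

definition monochromatic :: "('a \<Rightarrow> bool) \<Rightarrow> 'a set \<Rightarrow> bool" where
  "monochromatic c X \<longleftrightarrow> (\<forall>x\<in>X. \<forall>y\<in>X. c x = c y)"

lemma monochromaticD: "monochromatic c X \<Longrightarrow> x \<in> X \<Longrightarrow> y \<in> X \<Longrightarrow> c x = c y"
  unfolding monochromatic_def by (drule (1) bspec, drule (1) bspec)

definition proper :: "'a set set \<Rightarrow> ('a \<Rightarrow> bool) \<Rightarrow> bool" where
  "proper E c \<longleftrightarrow> (\<forall>x y. {x, y} \<in> E \<longrightarrow> c x \<noteq> c y)"

definition common_neighbour :: "'a set set \<Rightarrow> 'a \<Rightarrow> 'a \<Rightarrow> bool" where
  "common_neighbour E x y \<longleftrightarrow> (\<exists>z. {x, z} \<in> E \<and> {z, y} \<in> E)"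

section \<open>Colourings and bipartitions\<close>

text \<open>With two colours, whether \<open>x\<close> and \<open>y\<close> agree is determined by
  whether each of them agrees with \<open>h\<close>, so one reference vertex suffices.\<close>

lemma same_bipartition_iff_ref:
  assumes "h \<in> V"
  shows "same_bipartition V c d \<longleftrightarrow> (\<forall>x\<in>V. (c x = c h) = (d x = d h))"
  using assms unfolding same_bipartition_def by blast

lemma same_bipartition_mono: "same_bipartition V c d \<Longrightarrow> U \<subseteq> V \<Longrightarrow> same_bipartition U c d"
  unfolding same_bipartition_def by blast

text \<open>Relative to a reference vertex \<open>h\<close>, the colourings coincide on
  \<open>V\<close> if they agree at \<open>h\<close> and are complementary otherwise; the unordered
  pair of classes ignores this swap.\<close>

lemma same_bipartition_iff_classes: "same_bipartition V c d \<longleftrightarrow> classes V c = classes V d"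
proof
  assume *: "same_bipartition V c d"
  show "classes V c = classes V d"
  proof (cases "V = {}")
    case False
    then obtain h where h: "h \<in> V" by blast
    with * have "\<forall>x\<in>V. (c x = c h) = (d x = d h)"
      by (simp add: same_bipartition_iff_ref)
    then have "(\<forall>x\<in>V. c x = d x) \<or> (\<forall>x\<in>V. c x = (\<not> d x))" by blast
    then show ?thesis
    proof
      assume "\<forall>x\<in>V. c x = d x"
      then have "{x\<in>V. c x} = {x\<in>V. d x}" "{x\<in>V. \<not> c x} = {x\<in>V. \<not> d x}" by auto
      then show ?thesis by (simp add: classes_def)
    next
      assume "\<forall>x\<in>V. c x = (\<not> d x)"
      then have "{x\<in>V. c x} = {x\<in>V. \<not> d x}" "{x\<in>V. \<not> c x} = {x\<in>V. d x}" by auto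
      then show ?thesis by (simp add: classes_def insert_commute)
    qed
  qed (simp add: classes_def)
next
  assume "classes V c = classes V d"
  then have "{x\<in>V. c x} = {x\<in>V. d x} \<or> {x\<in>V. c x} = {x\<in>V. \<not> d x}"
    by (auto simp: classes_def doubleton_eq_iff)
  then show "same_bipartition V c d" unfolding same_bipartition_def by blast
qed

lemma balanced_bipartitions_eq_classes:
  "balanced_bipartitions V = classes V ` {c. balanced V c}"
proof (intro equalityI subsetI)
  fix p assume "p \<in> balanced_bipartitions V"
  then obtain A B where p: "p = {A, B}" "A \<union> B = V" "A \<inter> B = {}"
    "\<bar>int (card A) - int (card B)\<bar> \<le> 1"
    unfolding balanced_bipartitions_def by blast
  then have "{x\<in>V. x \<in> A} = A" "{x\<in>V. x \<notin> A} = B" by auto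
  with p show "p \<in> classes V ` {c. balanced V c}"
    by (intro image_eqI[of _ _ "\<lambda>x. x \<in> A"]) (auto simp: classes_def balanced_def)
next
  fix p assume "p \<in> classes V ` {c. balanced V c}"
  then obtain c where "p = classes V c" "balanced V c" by blast
  then show "p \<in> balanced_bipartitions V"
    unfolding balanced_bipartitions_def classes_def balanced_def by blast
qed

text \<open>The oppositely coloured sets \<open>X\<close> and \<open>Y\<close> add the same number
  to both colour classes, so deleting them leaves the difference unchanged.\<close>

lemma balanced_remove:
  assumes "finite U" "finite X" "finite Y" "U \<inter> X = {}" "U \<inter> Y = {}" "X \<inter> Y = {}"
    and "card X = card Y" "x \<in> X" "y \<in> Y" "c x \<noteq> c y"
    and "\<forall>z\<in>X. c z = c x" "\<forall>z\<in>Y. c z = c y" "balanced (X \<union> Y \<union> U) c"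
  shows "balanced U c"
proof -
  have *: "card {z \<in> X \<union> Y \<union> U. P z} = card {z\<in>X. P z} + card {z\<in>Y. P z} + card {z\<in>U. P z}"
    for P
  proof -
    have "{z \<in> X \<union> Y \<union> U. P z} = ({z\<in>X. P z} \<union> {z\<in>Y. P z}) \<union> {z\<in>U. P z}" by blast
    also have "card \<dots> = card {z\<in>X. P z} + card {z\<in>Y. P z} + card {z\<in>U. P z}"
      using assms(1-6) by (subst card_Un_disjoint; (subst card_Un_disjoint)?) auto
    finally show ?thesis .
  qed
  show ?thesis
  proof (cases "c x")
    case True
    then have e: "{z\<in>X. c z} = X" "{z\<in>Y. c z} = {}" "{z\<in>X. \<not> c z} = {}" "{z\<in>Y. \<not> c z} = Y"
      using assms(10-12) by auto
    show ?thesis using assms(7,13) unfolding balanced_def * e by simp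
  next
    case False
    then have e: "{z\<in>X. c z} = {}" "{z\<in>Y. c z} = Y" "{z\<in>X. \<not> c z} = X" "{z\<in>Y. \<not> c z} = {}"
      using assms(10-12) by auto
    show ?thesis using assms(7,13) unfolding balanced_def * e by simp
  qed
qed

text \<open>A vertex \<open>w\<close> sharing the colour of \<open>M\<close> would give that colour
  at least \<open>card M + 1\<close> vertices and leave at most \<open>card W - 1\<close> for the
  other, too large a gap for balance.\<close>

lemma balanced_forces_minority:
  assumes "finite M" "finite W" "M \<inter> W = {}" "card W < card M" "m \<in> M" "\<forall>x\<in>M. c x = c m"
    and "balanced (M \<union> W) c" "w \<in> W"
  shows "c w \<noteq> c m"
proof
  assume w: "c w = c m"
  let ?T = "{x \<in> M \<union> W. c x = c m}" and ?F = "{x \<in> M \<union> W. c x \<noteq> c m}"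
  have "insert w M \<subseteq> ?T" using assms(5,6,8) w by blast
  then have "card (insert w M) \<le> card ?T" using assms(1,2) by (intro card_mono) auto
  moreover have "w \<notin> M" using assms(3,8) by blast
  ultimately have T: "Suc (card M) \<le> card ?T" using assms(1) by simp
  have "?F \<subseteq> W - {w}" using assms(6) w by blast
  then have "card ?F \<le> card (W - {w})" using assms(2) by (intro card_mono) auto
  then have F: "Suc (card ?F) \<le> card W"
    using assms(2,8) card_Suc_Diff1[of W w] by simp
  have "\<bar>int (card ?T) - int (card ?F)\<bar> \<le> 1"
    using assms(7) by (cases "c m") (simp_all add: balanced_def)
  with T F assms(4) show False by linarith
qed

section \<open>Edges of a path\<close>

lemma path_edges_Nil [simp]: "path_edges [] = {}"
  and path_edges_single [simp]: "path_edges [x] = {}"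
  by (auto simp: path_edges_def)

lemma path_edges_Cons_Cons [simp]:
  "path_edges (x # y # zs) = insert {x, y} (path_edges (y # zs))"
proof -
  have "{i. Suc i < length (x # y # zs)} = insert 0 (Suc ` {i. Suc i < length (y # zs)})"
    by (auto simp: image_iff less_Suc_eq_0_disj)
  moreover have "path_edges xs = (\<lambda>i. {xs ! i, xs ! Suc i}) ` {i. Suc i < length xs}" for xs :: "'a list"
    by (auto simp: path_edges_def)
  ultimately show ?thesis by (simp add: image_image)
qed

lemma path_edges_Cons: "xs \<noteq> [] \<Longrightarrow> path_edges (x # xs) = insert {x, hd xs} (path_edges xs)"
  by (cases xs) simp_all

lemma path_edges_append:
  "path_edges (xs @ ys) = path_edges xs \<union> path_edges ys \<union>
    (if xs = [] \<or> ys = [] then {} else {{last xs, hd ys}})"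
proof (induction xs)
  case (Cons x xs)
  then show ?case by (cases "xs = []"; cases "ys = []") (simp_all add: path_edges_Cons insert_commute)
qed simp

lemma path_edges_rev [simp]: "path_edges (rev xs) = path_edges xs"
proof (induction xs)
  case (Cons x xs)
  then show ?case
    by (cases "xs = []")
      (simp_all add: path_edges_append path_edges_Cons last_rev insert_commute[of x "hd xs"])
qed simp

lemma path_edges_no_loop: "distinct xs \<Longrightarrow> {x, y} \<in> path_edges xs \<Longrightarrow> x \<noteq> y"
  by (auto simp: path_edges_def doubleton_eq_iff nth_eq_iff_index_eq)

lemma path_edges_subset: "e \<in> path_edges xs \<Longrightarrow> e \<subseteq> set xs"
  by (auto simp: path_edges_def)

section \<open>Alternating colourings and the absence of triangles in a path\<close>

text \<open>Balance alone would not carry the induction. Fixing the colour of the head also fixes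
  the sign of the difference: prepending a vertex and flipping the old colours turns a difference
  \<open>k\<close> into \<open>1 - k\<close>, which preserves {0, 1}.\<close>

lemma path_alternating_colouring:
  assumes "distinct xs"
  shows "\<exists>c. proper (path_edges xs) c \<and> (xs \<noteq> [] \<longrightarrow> c (hd xs)) \<and>
    int (card {x \<in> set xs. c x}) - int (card {x \<in> set xs. \<not> c x}) \<in> {0, 1}"
  using assms
proof (induction xs)
  case (Cons x xs)
  then obtain c where c: "proper (path_edges xs) c" "xs \<noteq> [] \<longrightarrow> c (hd xs)"
    "int (card {x \<in> set xs. c x}) - int (card {x \<in> set xs. \<not> c x}) \<in> {0, 1}"
    by auto
  define d where "d = (\<lambda>y. y = x \<or> \<not> c y)"
  have x: "x \<notin> set xs" using Cons.prems by simp
  have "{y \<in> set (x # xs). d y} = insert x {y \<in> set xs. \<not> c y}"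
    "{y \<in> set (x # xs). \<not> d y} = {y \<in> set xs. c y}"
    using x by (auto simp: d_def)
  then have "int (card {y \<in> set (x # xs). d y}) - int (card {y \<in> set (x # xs). \<not> d y}) \<in> {0, 1}"
    using c(3) x by auto
  moreover have "proper (path_edges (x # xs)) d"
  proof -
    have "proper (path_edges xs) d"
      using c(1) x path_edges_subset[of _ xs] unfolding proper_def d_def by blast
    then show ?thesis
      using c(2) x by (cases xs) (auto simp: proper_def d_def doubleton_eq_iff)
  qed
  moreover have "d (hd (x # xs))" by (simp add: d_def)
  ultimately show ?case by blast
qed (auto simp: proper_def)

lemma hamiltonian_path_colouring:
  assumes "hamiltonian_path V P"
  shows "\<exists>c. proper P c \<and> balanced V c"
proof -
  obtain xs where "distinct xs" "set xs = V" "P = path_edges xs"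
    using assms by (auto simp: hamiltonian_path_def)
  with path_alternating_colouring[of xs] show ?thesis
    by (auto simp: balanced_def)
qed

lemma hamiltonian_path_edge_subset: "hamiltonian_path V P \<Longrightarrow> e \<in> P \<Longrightarrow> e \<subseteq> V"
  using path_edges_subset by (auto simp: hamiltonian_path_def)

lemma proper_no_triangle: "proper E c \<Longrightarrow> \<not> contains_triangle E"
  unfolding proper_def contains_triangle_def by blast

text \<open>This keeps the constructed paths distinct: if two bipartitions shared a path, its union
  with itself would have to contain a triangle.\<close>

lemma hamiltonian_path_no_triangle: "hamiltonian_path V P \<Longrightarrow> \<not> contains_triangle P"
  using hamiltonian_path_colouring proper_no_triangle by blast

text \<open>The edges of \<open>Q\<close> lie inside \<open>V\<close>, where \<open>c\<close> and
  \<open>d\<close> separate the same pairs, so \<open>c\<close> is proper for \<open>Q\<close> as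
  well and the union is bipartite.\<close>

lemma same_bipartition_no_triangle:
  assumes "proper P c" "proper Q d" "same_bipartition V c d"
    and "hamiltonian_path V P" "hamiltonian_path V Q"
  shows "\<not> contains_triangle (P \<union> Q)"
proof (rule proper_no_triangle[of _ c])
  show "proper (P \<union> Q) c"
    using assms(1-3) hamiltonian_path_edge_subset[OF assms(5)]
    unfolding proper_def same_bipartition_def by blast
qed

section \<open>The construction\<close>

lemma contains_triangle_mono: "contains_triangle E \<Longrightarrow> E \<subseteq> E' \<Longrightarrow> contains_triangle E'"
  unfolding contains_triangle_def by blast

lemma common_neighbour_mono: "common_neighbour E x y \<Longrightarrow> E \<subseteq> E' \<Longrightarrow> common_neighbour E' x y"
  unfolding common_neighbour_def by blast

lemma common_neighbour_sym: "common_neighbour E x y \<Longrightarrow> common_neighbour E y x"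
proof -
  assume "common_neighbour E x y"
  then obtain z where "{x, z} \<in> E" "{z, y} \<in> E" by (auto simp: common_neighbour_def)
  then have "{y, z} \<in> E" "{z, x} \<in> E"
    by (simp_all add: insert_commute[of y z] insert_commute[of z x])
  then show ?thesis unfolding common_neighbour_def by blast
qed

lemma successively_common_neighbour_rev:
  "successively (common_neighbour E) (rev xs) \<longleftrightarrow> successively (common_neighbour E) xs"
proof -
  have "(\<lambda>x y. common_neighbour E y x) = common_neighbour E"
    by (intro ext iffI; erule common_neighbour_sym)
  then show ?thesis by (simp only: successively_rev)
qed

lemma successively_common_neighbour_mono:
  assumes "successively (common_neighbour E) xs" "E \<subseteq> E'"
  shows "successively (common_neighbour E') xs"
  using assms by (auto intro: successively_mono common_neighbour_mono)

lemma common_neighbour_adjacent_triangle: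
  assumes "common_neighbour (path_edges xs) x y" "{x, y} \<in> E" "distinct xs" "x \<noteq> y"
  shows "contains_triangle (path_edges xs \<union> E)"
proof -
  obtain z where z: "{x, z} \<in> path_edges xs" "{z, y} \<in> path_edges xs"
    using assms(1) by (auto simp: common_neighbour_def)
  with assms(3) have "x \<noteq> z" "z \<noteq> y" by (auto dest: path_edges_no_loop)
  with z assms(2,4) show ?thesis unfolding contains_triangle_def by blast
qed

section \<open>Interleaved lists\<close>

lemma set_splice: "set (splice xs ys) = set xs \<union> set ys"
  by (rule set_shuffles) simp

lemma distinct_splice:
  "distinct xs \<Longrightarrow> distinct ys \<Longrightarrow> set xs \<inter> set ys = {} \<Longrightarrow> distinct (splice xs ys)"
  by (erule (2) distinct_disjoint_shuffles) simp

text \<open>Consecutive entries of one list are separated by a single entry of the other for as long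
  as the latter lasts. The list that starts may be longer by one. Both halves are proved together
  because the recursion of \<open>splice\<close> exchanges its arguments, and with them the two
  length conditions.\<close>

lemma splice_common_neighbours:
  "(length xs \<le> Suc (length ys) \<longrightarrow> successively (common_neighbour (path_edges (splice xs ys))) xs) \<and>
   (length ys \<le> length xs \<longrightarrow> successively (common_neighbour (path_edges (splice xs ys))) ys)"
proof (induction xs ys rule: splice.induct)
  case (2 x xs ys)
  have sub: "path_edges (splice ys xs) \<subseteq> path_edges (splice (x # xs) ys)"
    by (cases "splice ys xs") auto
  note mono = successively_common_neighbour_mono[OF _ sub]
  have "successively (common_neighbour (path_edges (splice (x # xs) ys))) (x # xs)"
    if le: "length xs \<le> length ys"
  proof (cases xs)
    case (Cons x' xs')
    then obtain y ys' where ys: "ys = y # ys'" using le by (cases ys) auto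
    have "common_neighbour (path_edges (splice (x # xs) ys)) x x'"
      unfolding common_neighbour_def using ys Cons by (intro exI[of _ y]) simp
    moreover have "successively (common_neighbour (path_edges (splice (x # xs) ys))) xs"
      using 2 le by (intro mono) simp
    ultimately show ?thesis using Cons by simp
  qed simp
  moreover have "successively (common_neighbour (path_edges (splice (x # xs) ys))) ys"
    if "length ys \<le> Suc (length xs)"
    using 2 that by (intro mono) simp
  ultimately show ?case by simp
qed simp

lemma successively_concatD: "successively P (concat xss) \<Longrightarrow> xs \<in> set xss \<Longrightarrow> successively P xs"
  by (induction xss) (auto simp: successively_append_iff)

text \<open>The entries are among 1, 2, ..., 2^(k-1), which add up to 2^k - 1. Hence among runs of
  distinct lengths the longest outweighs all others together.\<close>

lemma sum_distinct_powers_of_2: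
  assumes "distinct ns" "\<forall>n\<in>set ns. n < 2 ^ k \<and> (\<exists>j. n = 2 ^ j)"
  shows "sum_list ns < (2 ^ k :: nat)"
proof -
  have "set ns \<subseteq> (\<lambda>j. 2 ^ j) ` {0..<k}"
    using assms(2) by (auto simp: image_iff)
  then have "sum_list ns \<le> sum (\<lambda>n. n) ((\<lambda>j. 2 ^ j) ` {0..<k})"
    using assms(1) by (subst distinct_sum_list_conv_Sum) (auto intro!: sum_mono2)
  also have "\<dots> = (\<Sum>j = 0..<k. 2 ^ j)"
    by (subst sum.reindex) (auto simp: inj_on_def)
  also have "\<dots> < 2 ^ k" by (simp add: sum_power2)
  finally show ?thesis .
qed

section \<open>Coding colourings by paths\<close>

text \<open>These are the colourings still possible when every comparison inside a run has returned
  equality and the removed blocks are disregarded.\<close>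

definition run_colourings :: "'a list list \<Rightarrow> ('a \<Rightarrow> bool) set" where
  "run_colourings rs = {c. balanced (set (concat rs)) c \<and>
    (\<forall>r\<in>set rs. monochromatic c (set r))}"

text \<open>The values are vertex lists, not edge sets, because a block is later attached at the
  head of the list. The condition on runs is the invariant that turns an earlier comparison with the
  opposite answer into a triangle. Equal lists for the same bipartition ensure that, once the rests
  agree, only the form of the block matters.\<close>

definition triangle_coding :: "'a list list \<Rightarrow> (('a \<Rightarrow> bool) \<Rightarrow> 'a list) \<Rightarrow> bool" where
  "triangle_coding rs f \<longleftrightarrow>
    (\<forall>c\<in>run_colourings rs. distinct (f c) \<and> set (f c) = set (concat rs) \<and>
      (\<forall>r\<in>set rs. successively (common_neighbour (path_edges (f c))) r)) \<and>
    (\<forall>c\<in>run_colourings rs. \<forall>d\<in>run_colourings rs.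
      (if same_bipartition (set (concat rs)) c d then f c = f d
       else contains_triangle (path_edges (f c) \<union> path_edges (f d))))"

text \<open>Balance forces the longest run \<open>M\<close> to be one colour class and the
  concatenation \<open>W\<close> of the others to be the other. Only one bipartition is possible, so
  a constant coding works.\<close>

lemma triangle_coding_distinct_lengths:
  assumes dist: "distinct (concat rs)" and pow: "\<forall>r\<in>set rs. \<exists>k. length r = 2 ^ k"
    and len: "distinct (map length rs)"
  shows "\<exists>f. triangle_coding rs f"
proof (cases "rs = []")
  case True
  then show ?thesis
    by (intro exI[of _ "\<lambda>_. []"]) (simp add: triangle_coding_def same_bipartition_def)
next
  case False
  have "Max (length ` set rs) \<in> length ` set rs" using False by (intro Max_in) auto
  then obtain M where M0: "M \<in> set rs" "length M = Max (length ` set rs)" by auto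
  then have M: "M \<in> set rs" "\<And>r. r \<in> set rs \<Longrightarrow> length r \<le> length M" by auto
  obtain as bs where rs: "rs = as @ M # bs" using split_list[OF M(1)] by blast
  obtain k where k: "length M = 2 ^ k" using bspec[OF pow M(1)] by blast
  define W where "W = concat (as @ bs)"
  have less: "n < 2 ^ k" if n: "n \<in> length ` set (as @ bs)" for n
  proof -
    obtain r where r: "r \<in> set (as @ bs)" "n = length r" using n by blast
    then have "length r \<noteq> length M" using len rs by (force simp: image_iff)
    moreover have "length r \<le> length M" using r M(2) rs by simp
    ultimately show ?thesis using r k by simp
  qed
  have "length W = sum_list (map length (as @ bs))"
    by (simp add: W_def length_concat)
  also have "\<dots> < 2 ^ k"
    using len less pow by (intro sum_distinct_powers_of_2) (auto simp: rs)
  finally have W: "length W < length M" using k by simp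
  have V: "set (concat rs) = set M \<union> set W" "set M \<inter> set W = {}" "distinct M" "distinct W"
    using dist by (auto simp: rs W_def)
  obtain m where m: "m \<in> set M" using k by (cases M) auto
  have col: "(e x = e m) \<longleftrightarrow> x \<in> set M"
    if e: "e \<in> run_colourings rs" and x: "x \<in> set (concat rs)" for e x
  proof (cases "x \<in> set M")
    case True
    then show ?thesis using e m M(1) unfolding run_colourings_def monochromatic_def by blast
  next
    case False
    have "e x \<noteq> e m"
    proof (rule balanced_forces_minority[OF _ _ V(2) _ m])
      show "card (set W) < card (set M)" using V W by (simp add: distinct_card)
      show "\<forall>u\<in>set M. e u = e m" using e m M(1) unfolding run_colourings_def monochromatic_def by blast
      show "balanced (set M \<union> set W) e" using e V by (simp add: run_colourings_def)
      show "x \<in> set W" using x False V by blast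
    qed simp_all
    with False show ?thesis by simp
  qed
  have same: "same_bipartition (set (concat rs)) c d"
    if "c \<in> run_colourings rs" "d \<in> run_colourings rs" for c d
  proof -
    have "m \<in> set (concat rs)" using m V(1) by blast
    moreover have "\<forall>x\<in>set (concat rs). (c x = c m) = (d x = d m)"
      using col[OF that(1)] col[OF that(2)] by blast
    ultimately show ?thesis by (simp only: same_bipartition_iff_ref)
  qed
  have run: "successively (common_neighbour (path_edges (splice M W))) r"
    if e: "e \<in> run_colourings rs" and r: "r \<in> set rs" for e r
  proof (cases "r = M")
    case True
    \<comment> \<open>For \<open>M\<close> to have common neighbours throughout, it may exceed
      \<open>W\<close> by at most one vertex. Balance of the given colouring \<open>e\<close>
      supplies this; if there is no such colouring, nothing is required.\<close>
    have "{x \<in> set (concat rs). e x = e m} = set M" "{x \<in> set (concat rs). e x \<noteq> e m} = set W"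
      using col[OF e] V(1,2) by blast+
    moreover have bal: "balanced (set (concat rs)) e" using e by (simp add: run_colourings_def)
    have "\<bar>int (card {x \<in> set (concat rs). e x = e m})
        - int (card {x \<in> set (concat rs). e x \<noteq> e m})\<bar> \<le> 1"
      using bal unfolding balanced_def by (cases "e m") (simp_all add: abs_minus_commute)
    ultimately have "length M \<le> Suc (length W)"
      using V(3,4) by (simp add: distinct_card)
    then show ?thesis using splice_common_neighbours[of M W] True by simp
  next
    case False
    then have "r \<in> set (as @ bs)" using r rs by auto
    \<comment> \<open>Each other run is a contiguous segment of \<open>W\<close>, so common
      neighbours along \<open>W\<close> serve all of them.\<close>
    moreover have "successively (common_neighbour (path_edges (splice M W))) W"
      using splice_common_neighbours[of M W] W by simp
    ultimately show ?thesis unfolding W_def by (rule successively_concatD[rotated])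
  qed
  have "distinct (splice M W)" "set (splice M W) = set (concat rs)"
    using V by (simp_all add: distinct_splice set_splice)
  with same run show ?thesis
    unfolding triangle_coding_def by (intro exI[of _ "\<lambda>_. splice M W"]) simp
qed

text \<open>Reversing \<open>r\<close> makes \<open>hd r\<close> and \<open>hd s\<close> consecutive in the joined run; these two vertices are
  adjacent in both forms of the block.\<close>

lemma triangle_coding_join:
  assumes dist: "distinct (concat (r # s # rs))" and len: "length r = length s" and ne: "r \<noteq> []"
    and f: "triangle_coding ((rev r @ s) # rs) f" and g: "triangle_coding rs g"
  shows "\<exists>h. triangle_coding (r # s # rs) h"
proof -
  obtain x r' where r: "r = x # r'" using ne by (cases r) auto
  obtain y s' where s: "s = y # s'" using len r by (cases s) auto
  let ?V = "set (concat (r # s # rs))"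
  \<comment> \<open>The block end next to \<open>hd (g c)\<close> is chosen with the opposite
    colour: \<open>y\<close> if \<open>hd (g c)\<close> is coloured like \<open>x\<close>, and
    \<open>x\<close> otherwise. When nothing remains, \<open>aligned\<close> is false for every
    colouring, so that the block does not depend on the value of \<open>hd []\<close>.\<close>
  define aligned where "aligned = (\<lambda>c. g c \<noteq> [] \<and> c (hd (g c)) = c x)"
  define block where "block = (\<lambda>c. if aligned c then splice s r else splice r s)"
  \<comment> \<open>The reversal brings the head of the block next to
    \<open>hd (g c)\<close>.\<close>
  define h where "h = (\<lambda>c. if c x = c y then f c else rev (block c) @ g c)"
  have disj: "set r \<inter> set s = {}" "distinct r" "distinct s" using dist by auto
  have xr: "x \<in> set r" and ys: "y \<in> set s" using r s by simp_all
  have mono: "u \<in> set r \<Longrightarrow> c u = c x" "u \<in> set s \<Longrightarrow> c u = c y"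
    if c: "c \<in> run_colourings (r # s # rs)" for c u
  proof -
    have m: "monochromatic c (set r)" "monochromatic c (set s)"
      using c by (simp_all add: run_colourings_def)
    show "c u = c x" if "u \<in> set r" by (rule monochromaticD[OF m(1) that xr])
    show "c u = c y" if "u \<in> set s" by (rule monochromaticD[OF m(2) that ys])
  qed
  have same: "c \<in> run_colourings ((rev r @ s) # rs)"
    if "c \<in> run_colourings (r # s # rs)" "c x = c y" for c
  proof -
    have a: "c u = c x" if u: "u \<in> set (rev r @ s)" for u
    proof (cases "u \<in> set r")
      case True
      then show ?thesis by (rule mono(1)[OF \<open>c \<in> run_colourings (r # s # rs)\<close>])
    next
      case False
      then have "u \<in> set s" using u by simp
      then have "c u = c y" by (rule mono(2)[OF \<open>c \<in> run_colourings (r # s # rs)\<close>])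
      with \<open>c x = c y\<close> show ?thesis by simp
    qed
    have "monochromatic c (set (rev r @ s))"
      unfolding monochromatic_def by (intro ballI) (rule trans[OF a sym[OF a]])
    with that(1) show ?thesis by (simp add: run_colourings_def Un_assoc)
  qed
  have diff: "c \<in> run_colourings rs"
    if "c \<in> run_colourings (r # s # rs)" "c x \<noteq> c y" for c
  proof -
    have cr: "\<forall>u\<in>set r. c u = c x" "\<forall>u\<in>set s. c u = c y"
      by (intro ballI mono[OF that(1)]; assumption)+
    have bal: "balanced ?V c" using that(1) by (simp add: run_colourings_def)
    have "balanced (set (concat rs)) c"
    proof (rule balanced_remove[OF _ _ _ _ _ disj(1) _ xr ys that(2) cr(1,2)])
      show "balanced (set r \<union> set s \<union> set (concat rs)) c" using bal by (simp add: Un_assoc)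
      show "card (set r) = card (set s)" using disj len by (simp add: distinct_card)
    qed (use dist in auto)
    with that(1) show ?thesis by (simp add: run_colourings_def)
  qed
  have fD: "distinct (f c)" "set (f c) = ?V"
    "\<And>q. q \<in> set ((rev r @ s) # rs) \<Longrightarrow> successively (common_neighbour (path_edges (f c))) q"
    if "c \<in> run_colourings ((rev r @ s) # rs)" for c
  proof -
    have *: "distinct (f c) \<and> set (f c) = set (concat ((rev r @ s) # rs)) \<and>
      (\<forall>q\<in>set ((rev r @ s) # rs). successively (common_neighbour (path_edges (f c))) q)"
      using f that unfolding triangle_coding_def by blast
    then show "distinct (f c)" "set (f c) = ?V" by (simp_all add: Un_assoc)
    show "successively (common_neighbour (path_edges (f c))) q" if "q \<in> set ((rev r @ s) # rs)" for q
      using * that by blast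
  qed
  have gD: "distinct (g c)" "set (g c) = set (concat rs)"
    "\<And>q. q \<in> set rs \<Longrightarrow> successively (common_neighbour (path_edges (g c))) q"
    if "c \<in> run_colourings rs" for c
    using g that unfolding triangle_coding_def by blast+
  have block_edges: "{x, y} \<in> path_edges (block c)" for c
    by (cases "aligned c") (simp_all add: block_def r s insert_commute[of x y])
  have blockD: "distinct (block c)" "set (block c) = set r \<union> set s"
    "path_edges (block c) \<subseteq> path_edges (rev (block c) @ g c)"
    "path_edges (g c) \<subseteq> path_edges (rev (block c) @ g c)"
    "{x, y} \<in> path_edges (rev (block c) @ g c)"
    "successively (common_neighbour (path_edges (block c))) r"
    "successively (common_neighbour (path_edges (block c))) s" for c
  proof -
    show "distinct (block c)" "set (block c) = set r \<union> set s"
      using disj by (simp_all add: block_def distinct_splice set_splice Int_commute Un_commute)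
    show sub: "path_edges (block c) \<subseteq> path_edges (rev (block c) @ g c)"
      "path_edges (g c) \<subseteq> path_edges (rev (block c) @ g c)"
      by (auto simp: path_edges_append)
    show "{x, y} \<in> path_edges (rev (block c) @ g c)" using block_edges sub(1) by blast
    show "successively (common_neighbour (path_edges (block c))) r"
      "successively (common_neighbour (path_edges (block c))) s"
      using len splice_common_neighbours[of r s] splice_common_neighbours[of s r]
      by (simp_all add: block_def)
  qed
  have hf: "distinct (h c) \<and> set (h c) = ?V \<and>
      (\<forall>q\<in>set (r # s # rs). successively (common_neighbour (path_edges (h c))) q)"
    if c: "c \<in> run_colourings (r # s # rs)" for c
  proof (cases "c x = c y")
    case True
    note F = fD[OF same[OF c True]]
    have runs: "successively (common_neighbour (path_edges (f c))) (rev r @ s)" by (rule F(3)) simp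
    then have "successively (common_neighbour (path_edges (f c))) (rev r)"
      by (simp add: successively_append_iff)
    then have "successively (common_neighbour (path_edges (f c))) r"
      by (simp only: successively_common_neighbour_rev)
    moreover have "successively (common_neighbour (path_edges (f c))) s"
      using runs by (simp add: successively_append_iff)
    moreover have "\<forall>q\<in>set rs. successively (common_neighbour (path_edges (f c))) q"
      using F(3) by simp
    ultimately show ?thesis using F(1,2) True by (simp add: h_def)
  next
    case False
    note G = gD[OF diff[OF c False]]
    have hc: "h c = rev (block c) @ g c" using False by (simp add: h_def)
    have "successively (common_neighbour (path_edges (h c))) q" if q: "q \<in> set (r # s # rs)" for q
    proof (cases "q \<in> set rs")
      case True
      then show ?thesis
        unfolding hc by (rule successively_common_neighbour_mono[OF G(3) blockD(4)])
    next
      case False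
      then have "q = r \<or> q = s" using q by simp
      then have "successively (common_neighbour (path_edges (block c))) q"
        using blockD(6,7)[of c] by (elim disjE) simp_all
      then show ?thesis
        unfolding hc by (rule successively_common_neighbour_mono[OF _ blockD(3)])
    qed
    moreover have "distinct (h c)" "set (h c) = ?V"
      using G(1,2) blockD(1,2)[of c] dist unfolding hc by (simp_all add: Un_assoc Int_Un_distrib Int_Un_distrib2)
    ultimately show ?thesis by blast
  qed
  have mixed: "contains_triangle (path_edges (h c) \<union> path_edges (h d))"
    if c: "c \<in> run_colourings (r # s # rs)" "c x = c y"
      and d: "d \<in> run_colourings (r # s # rs)" "d x \<noteq> d y" for c d
  proof -
    note F = fD[OF same[OF c]]
    have "successively (common_neighbour (path_edges (f c))) (rev r @ s)" by (rule F(3)) simp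
    then have "common_neighbour (path_edges (f c)) x y"
      using r s by (simp add: successively_append_iff)
    then show ?thesis
      using common_neighbour_adjacent_triangle[of "f c" x y] blockD(5) F(1) c(2) d(2) disj r s
      by (auto simp: h_def)
  qed
  have "if same_bipartition ?V c d then h c = h d
        else contains_triangle (path_edges (h c) \<union> path_edges (h d))"
    if c: "c \<in> run_colourings (r # s # rs)" and d: "d \<in> run_colourings (r # s # rs)" for c d
  proof -
    have xy: "x \<in> ?V" "y \<in> ?V" by (auto simp: r s)
    \<comment> \<open>The cases are the answers to comparing \<open>x\<close> with \<open>y\<close>.
      Two equal answers refer back to \<open>f\<close> or to \<open>g\<close>; different answers
      give the triangle of \<open>mixed\<close>.\<close>
    consider "c x = c y" "d x = d y" | "c x = c y" "d x \<noteq> d y" | "c x \<noteq> c y" "d x = d y"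
      | "c x \<noteq> c y" "d x \<noteq> d y" by blast
    then show ?thesis
    proof cases
      case 1
      with f same[OF c] same[OF d] show ?thesis
        by (auto simp: triangle_coding_def h_def Un_assoc)
    next
      case 2
      with mixed[OF c _ d] xy show ?thesis by (auto simp: same_bipartition_def)
    next
      case 3
      with mixed[OF d _ c] xy show ?thesis by (auto simp: same_bipartition_def Un_commute)
    next
      case 4
      note cr = diff[OF c 4(1)] and dr = diff[OF d 4(2)]
      show ?thesis
      proof (cases "same_bipartition (set (concat rs)) c d")
        case False
        then have "contains_triangle (path_edges (g c) \<union> path_edges (g d))"
          using g cr dr by (auto simp: triangle_coding_def)
        moreover have "\<not> same_bipartition ?V c d"
          using False same_bipartition_mono[of ?V c d "set (concat rs)"] by auto
        ultimately show ?thesis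
          using 4 blockD(4)[of c] blockD(4)[of d] by (auto simp: h_def elim!: contains_triangle_mono)
      next
        case True
        then have gcd: "g c = g d" using g cr dr by (auto simp: triangle_coding_def)
        show ?thesis
        proof (cases "aligned c = aligned d")
          case al: True
          \<comment> \<open>A vertex outside the block is compared with \<open>x\<close> by way of
            \<open>hd (g c)\<close>.\<close>
          have "(c u = c x) = (d u = d x)" if u: "u \<in> ?V" for u
          proof (cases "u \<in> set r \<union> set s")
            case True
            then show ?thesis using mono[OF c, of u] mono[OF d, of u] 4 by auto
          next
            case False
            then have u': "u \<in> set (concat rs)" using u by auto
            then have ne: "g c \<noteq> []" using gD(2)[OF cr] by force
            then have "hd (g c) \<in> set (concat rs)" using gD(2)[OF cr] hd_in_set by blast
            then have "\<forall>v\<in>set (concat rs). (c v = c (hd (g c))) = (d v = d (hd (g c)))"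
              using True by (simp only: same_bipartition_iff_ref)
            then have "(c u = c (hd (g c))) = (d u = d (hd (g c)))" using u' by (rule bspec)
            then show ?thesis using al ne gcd by (auto simp: aligned_def)
          qed
          then have "same_bipartition ?V c d" using xy by (subst same_bipartition_iff_ref[of x]) auto
          then show ?thesis using al gcd 4 by (simp add: h_def block_def)
        next
          case al: False
          then have ne: "g c \<noteq> []" using gcd by (auto simp: aligned_def)
          define b where "b = hd (g c)"
          have b: "b \<in> set (concat rs)" using gD(2)[OF cr] ne hd_in_set unfolding b_def by blast
          have "b \<in> ?V" using b by auto
          then have "\<not> same_bipartition ?V c d"
            using al xy gcd ne by (auto simp: aligned_def same_bipartition_def b_def)
          moreover have "contains_triangle (path_edges (h c) \<union> path_edges (h d))"
          proof -
            \<comment> \<open>One path attaches \<open>x\<close> to \<open>b\<close>, the other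
              attaches \<open>y\<close>, and both contain the edge between \<open>x\<close> and
              \<open>y\<close>.\<close>
            have "{x, b} \<in> path_edges (h c) \<union> path_edges (h d)"
              "{y, b} \<in> path_edges (h c) \<union> path_edges (h d)"
              using al 4 gcd ne
              by (auto simp: h_def block_def path_edges_append r s last_rev b_def)
            moreover have "{x, y} \<in> path_edges (h c) \<union> path_edges (h d)"
              using blockD(5) 4 by (simp add: h_def)
            moreover have "x \<noteq> y" "x \<noteq> b" "y \<noteq> b" using 4 b dist by (auto simp: r s)
            ultimately show ?thesis unfolding contains_triangle_def by blast
          qed
          ultimately show ?thesis by simp
        qed
      qed
    qed
  qed
  with hf show ?thesis unfolding triangle_coding_def by blast
qed

text \<open>The order of the runs is irrelevant, so two runs of equal length may be moved to the
  front.\<close>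

lemma triangle_coding_cong:
  assumes "set rs = set rs'"
  shows "triangle_coding rs f = triangle_coding rs' f"
proof -
  have "set (concat rs) = set (concat rs')" using assms by simp
  then have "run_colourings rs = run_colourings rs'"
    using assms by (simp add: run_colourings_def)
  then show ?thesis using assms unfolding triangle_coding_def by simp
qed

text \<open>Induction on the number of runs: a comparison of two equally long runs either merges
  them, which doubles a power of two, or removes both. It ends when all lengths are
  distinct.\<close>

lemma triangle_coding_exists:
  assumes "distinct (concat rs)" and "\<forall>r\<in>set rs. \<exists>k. length r = 2 ^ k"
  shows "\<exists>f. triangle_coding rs f"
  using assms
proof (induction rs rule: length_induct)
  case (1 rs)
  show ?case
  proof (cases "distinct (map length rs)")
    case True
    then show ?thesis using triangle_coding_distinct_lengths 1 by blast
  next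
    case False
    then obtain as r bs s cs where rs: "rs = as @ r # bs @ s # cs" and len: "length r = length s"
      by (auto dest!: not_distinct_decomp simp: map_eq_append_conv map_eq_Cons_conv append_eq_map_conv
          Cons_eq_map_conv)
    let ?qs = "as @ bs @ cs"
    have ne: "r \<noteq> []" using 1(3) by (auto simp: rs)
    have d: "distinct (concat (r # s # ?qs))" using 1(2) by (auto simp: rs)
    obtain k where k: "length r = 2 ^ k" using 1(3) by (auto simp: rs)
    have "length (rev r @ s) = 2 ^ Suc k" using k len by simp
    then have "\<exists>j. length (rev r @ s) = 2 ^ j" by blast
    then have pow: "\<forall>q\<in>set ((rev r @ s) # ?qs). \<exists>j. length q = 2 ^ j"
      using 1(3) by (simp add: rs)
    have "distinct (concat ((rev r @ s) # ?qs))" "distinct (concat ?qs)"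
      using d by auto
    moreover have "length ((rev r @ s) # ?qs) < length rs" "length ?qs < length rs"
      by (simp_all add: rs)
    ultimately have "\<exists>f. triangle_coding ((rev r @ s) # ?qs) f" "\<exists>g. triangle_coding ?qs g"
      using 1(1) pow by (meson list.set_intros(2))+
    then have "\<exists>h. triangle_coding (r # s # ?qs) h"
      using triangle_coding_join[OF d len] ne by blast
    moreover have "set (r # s # ?qs) = set rs" by (auto simp: rs)
    ultimately show ?thesis using triangle_coding_cong by blast
  qed
qed

section \<open>The maximum\<close>

lemma triangle_creating_family_card_le:
  assumes "finite V" "triangle_creating_family V F"
  shows "card F \<le> card (balanced_bipartitions V)"
proof -
  have "\<forall>P\<in>F. \<exists>c. proper P c \<and> balanced V c"
    using assms hamiltonian_path_colouring by (auto simp: triangle_creating_family_def)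
  then obtain c where c: "\<And>P. P \<in> F \<Longrightarrow> proper P (c P)" "\<And>P. P \<in> F \<Longrightarrow> balanced V (c P)"
    by metis
  have "balanced_bipartitions V \<subseteq> Pow (Pow V)"
    by (auto simp: balanced_bipartitions_def)
  then have "finite (balanced_bipartitions V)"
    using assms(1) by (simp add: finite_subset)
  moreover have "(\<lambda>P. classes V (c P)) ` F \<subseteq> balanced_bipartitions V"
    using c(2) by (auto simp: balanced_bipartitions_eq_classes)
  moreover have "inj_on (\<lambda>P. classes V (c P)) F"
  proof (rule inj_onI, rule ccontr)
    fix P Q assume PQ: "P \<in> F" "Q \<in> F" "classes V (c P) = classes V (c Q)" "P \<noteq> Q"
    then have "\<not> contains_triangle (P \<union> Q)"
      using assms(2) c(1) same_bipartition_no_triangle[of P "c P" Q "c Q" V]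
      by (auto simp: same_bipartition_iff_classes triangle_creating_family_def)
    with PQ assms(2) show False by (auto simp: triangle_creating_family_def)
  qed
  ultimately show ?thesis by (meson card_inj_on_le)
qed

lemma triangle_creating_family_attained:
  assumes "finite V"
  shows "\<exists>F. triangle_creating_family V F \<and> card F = card (balanced_bipartitions V)"
proof -
  obtain vs where vs: "set vs = V" "distinct vs"
    using finite_distinct_list[OF assms] by blast
  let ?rs = "map (\<lambda>v. [v]) vs"
  have "\<forall>r\<in>set ?rs. \<exists>k. length r = 2 ^ k" by (auto intro: exI[of _ 0])
  moreover have conc: "concat ?rs = vs" by (induction vs) auto
  ultimately obtain f where f: "triangle_coding ?rs f"
    using triangle_coding_exists[of ?rs] vs by auto
  have col: "run_colourings ?rs = {c. balanced V c}"
    using vs conc by (auto simp: run_colourings_def monochromatic_def)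
  have ham: "hamiltonian_path V (path_edges (f c))" if "balanced V c" for c
  proof -
    have "distinct (f c) \<and> set (f c) = V"
      using f that unfolding triangle_coding_def col conc vs(1) by blast
    then show ?thesis by (auto simp: hamiltonian_path_def)
  qed
  have tri: "contains_triangle (path_edges (f c) \<union> path_edges (f d))"
    if "balanced V c" "balanced V d" "classes V c \<noteq> classes V d" for c d
  proof -
    have "if same_bipartition V c d then f c = f d
        else contains_triangle (path_edges (f c) \<union> path_edges (f d))"
      using f that(1,2) unfolding triangle_coding_def col conc vs(1) by blast
    with that(3) show ?thesis by (simp add: same_bipartition_iff_classes)
  qed
  \<comment> \<open>One colouring is selected for each bipartition, which settles the ambiguity of
    swapping colours.\<close>
  have "\<forall>p\<in>balanced_bipartitions V. \<exists>c. balanced V c \<and> classes V c = p"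
    by (auto simp: balanced_bipartitions_eq_classes)
  then obtain c where c: "\<And>p. p \<in> balanced_bipartitions V \<Longrightarrow> balanced V (c p)"
    "\<And>p. p \<in> balanced_bipartitions V \<Longrightarrow> classes V (c p) = p" by metis
  let ?P = "\<lambda>p. path_edges (f (c p))"
  have "inj_on ?P (balanced_bipartitions V)"
  proof (rule inj_onI, rule ccontr)
    fix p q assume "p \<in> balanced_bipartitions V" "q \<in> balanced_bipartitions V" "?P p = ?P q" "p \<noteq> q"
    with tri[of "c p" "c q"] c have "contains_triangle (?P p)" by simp
    with ham c \<open>p \<in> _\<close> show False using hamiltonian_path_no_triangle by blast
  qed
  then have "card (?P ` balanced_bipartitions V) = card (balanced_bipartitions V)"
    by (rule card_image)
  moreover have "triangle_creating_family V (?P ` balanced_bipartitions V)"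
    unfolding triangle_creating_family_def
  proof (intro conjI ballI impI)
    fix P assume "P \<in> ?P ` balanced_bipartitions V"
    then show "hamiltonian_path V P" using ham c by auto
  next
    fix P Q assume "P \<in> ?P ` balanced_bipartitions V" "Q \<in> ?P ` balanced_bipartitions V" "P \<noteq> Q"
    then obtain p q where "p \<in> balanced_bipartitions V" "q \<in> balanced_bipartitions V"
      "P = ?P p" "Q = ?P q" "p \<noteq> q" by auto
    then show "contains_triangle (P \<union> Q)" using tri[of "c p" "c q"] c by simp
  qed
  ultimately show ?thesis by blast
qed

section \<open>Counting balanced bipartitions\<close>

text \<open>The parts have sizes \<open>m\<close> and \<open>m + 1\<close>, so the smaller one
  identifies the unordered partition.\<close>

lemma balanced_bipartitions_odd:
  assumes "finite V" "card V = 2 * m + 1"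
  shows "card (balanced_bipartitions V) = (2 * m + 1) choose m"
proof -
  let ?S = "{A. A \<subseteq> V \<and> card A = m}"
  have co: "card (V - A) = m + 1" if "A \<in> ?S" for A
    using that assms by (subst card_Diff_subset) (auto intro: finite_subset)
  have "balanced_bipartitions V = (\<lambda>A. {A, V - A}) ` ?S"
  proof (intro equalityI subsetI)
    fix p assume "p \<in> balanced_bipartitions V"
    then obtain A B where AB: "p = {A, B}" "A \<union> B = V" "A \<inter> B = {}"
      "\<bar>int (card A) - int (card B)\<bar> \<le> 1"
      unfolding balanced_bipartitions_def by blast
    then have fin: "finite A" "finite B" using assms(1) by auto
    then have "card A + card B = 2 * m + 1"
      using AB(2,3) assms(2) card_Un_disjoint by metis
    then have "card A = m \<or> card B = m" using AB(4) by linarith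
    moreover have "V - A = B" "V - B = A" using AB by auto
    ultimately show "p \<in> (\<lambda>A. {A, V - A}) ` ?S"
      using AB(1,2) by (auto simp: image_iff)
  next
    fix p assume "p \<in> (\<lambda>A. {A, V - A}) ` ?S"
    then obtain A where "A \<in> ?S" "p = {A, V - A}" by blast
    moreover have "A \<union> (V - A) = V" using \<open>A \<in> ?S\<close> by blast
    moreover have "\<bar>int (card A) - int (card (V - A))\<bar> \<le> 1"
      using \<open>A \<in> ?S\<close> co[OF \<open>A \<in> ?S\<close>] by simp
    ultimately show "p \<in> balanced_bipartitions V"
      unfolding balanced_bipartitions_def by blast
  qed
  moreover have "inj_on (\<lambda>A. {A, V - A}) ?S"
    using co by (auto simp: inj_on_def doubleton_eq_iff)
  ultimately show ?thesis using n_subsets[OF assms(1), of m] assms(2) by (simp add: card_image)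
qed

text \<open>By parity both parts have size \<open>m + 1\<close>, so size cannot tell them apart. A
  fixed vertex \<open>v\<close> selects a part instead, and the rest of that part is an arbitrary
  \<open>m\<close>-subset of the other \<open>2 * m + 1\<close> vertices.\<close>

lemma balanced_bipartitions_even:
  assumes "finite V" "card V = 2 * m + 2"
  shows "card (balanced_bipartitions V) = (2 * m + 1) choose m"
proof -
  obtain v where v: "v \<in> V" using assms(2) by fastforce
  let ?S = "{A. A \<subseteq> V - {v} \<and> card A = m}"
  have half: "card (insert v A) = m + 1" "card (V - insert v A) = m + 1" if "A \<in> ?S" for A
  proof -
    have A: "finite A" "v \<notin> A" using that assms(1) by (auto intro: finite_subset)
    then show "card (insert v A) = m + 1" using that by simp
    then show "card (V - insert v A) = m + 1"
      using that A v assms by (subst card_Diff_subset) auto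
  qed
  have "balanced_bipartitions V = (\<lambda>A. {insert v A, V - insert v A}) ` ?S"
  proof (intro equalityI subsetI)
    fix p assume "p \<in> balanced_bipartitions V"
    then obtain C D where CD: "p = {C, D}" "C \<union> D = V" "C \<inter> D = {}"
      "\<bar>int (card C) - int (card D)\<bar> \<le> 1"
      unfolding balanced_bipartitions_def by blast
    define A B where "A = (if v \<in> C then C else D)" and "B = (if v \<in> C then D else C)"
    have AB: "p = {A, B}" "A \<union> B = V" "A \<inter> B = {}"
      "\<bar>int (card A) - int (card B)\<bar> \<le> 1" "v \<in> A"
      using CD v by (auto simp: A_def B_def)
    then have fin: "finite A" "finite B" using assms(1) by auto
    then have "card A + card B = 2 * m + 2"
      using AB(2,3) assms(2) card_Un_disjoint by metis
    then have "card A = m + 1" using AB(4) by linarith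
    then have "A - {v} \<in> ?S" using AB fin by auto
    moreover have "p = {insert v (A - {v}), V - insert v (A - {v})}" using AB by auto
    ultimately show "p \<in> (\<lambda>A. {insert v A, V - insert v A}) ` ?S" by blast
  next
    fix p assume "p \<in> (\<lambda>A. {insert v A, V - insert v A}) ` ?S"
    then obtain A where "A \<in> ?S" "p = {insert v A, V - insert v A}" by blast
    moreover have "insert v A \<union> (V - insert v A) = V" using \<open>A \<in> ?S\<close> v by blast
    moreover have "\<bar>int (card (insert v A)) - int (card (V - insert v A))\<bar> \<le> 1"
      using half[OF \<open>A \<in> ?S\<close>] by simp
    ultimately show "p \<in> balanced_bipartitions V"
      unfolding balanced_bipartitions_def by blast
  qed
  moreover have "inj_on (\<lambda>A. {insert v A, V - insert v A}) ?S"
  proof (rule inj_onI)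
    fix A B assume AB: "A \<in> ?S" "B \<in> ?S"
      "{insert v A, V - insert v A} = {insert v B, V - insert v B}"
    then have "insert v A = insert v B" by (auto simp: doubleton_eq_iff)
    with AB show "A = B" by blast
  qed
  ultimately show ?thesis
    using n_subsets[of "V - {v}" m] assms v by (simp add: card_image)
qed

theorem theorem1p4:
  fixes V :: "'a set"
  assumes "finite V" and "card V \<ge> 2"
  shows "Max {card F | F. triangle_creating_family V F} = card (balanced_bipartitions V)
    \<and> (\<forall>m. card V = 2 * m + 1 \<or> card V = 2 * m + 2 \<longrightarrow>
           card (balanced_bipartitions V) = (2 * m + 1) choose m)"
proof (intro conjI allI impI)
  show "Max {card F | F. triangle_creating_family V F} = card (balanced_bipartitions V)"
  proof (rule Max_eqI)
    show "finite {card F | F. triangle_creating_family V F}"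
      using finite_triangle_creating_families[OF assms(1)] by simp
    show "n \<le> card (balanced_bipartitions V)" if "n \<in> {card F | F. triangle_creating_family V F}" for n
      using that triangle_creating_family_card_le[OF assms(1)] by blast
    show "card (balanced_bipartitions V) \<in> {card F | F. triangle_creating_family V F}"
      using triangle_creating_family_attained[OF assms(1)] by (metis (mono_tags, lifting) mem_Collect_eq)
  qed
qed (use assms(1) balanced_bipartitions_odd balanced_bipartitions_even in blast)

end
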